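(* Let $x\mapsto (Ax,x)$ be a positive definite quadratic form on the space $\mathbb{R}^{N^2}$ of real $N\times N$ matrices, let $f$ be a real $N\times N$ matrix, and let $$\Phi(x)=\frac12(Ax,x)-\frac{N}{p}\,|\det x|^{p/N}-(f,x).$$ If $p>2$, there is at least one non-trivial critical point for $\Phi$, i.e. a matrix $x\neq0$ with $\Phi'(x)=0$.
   Context: $(\cdot,\cdot)$ is the standard entrywise inner product on the space $\mathbb{R}^{N^2}$ of real $N\times N$ matrices, and $A:\mathbb{R}^{N^2}\to\mathbb{R}^{N^2}$ is the symmetric positive definite linear operator representing the quadratic form. A critical point of $\Phi$ is a point $x$ at which $\Phi$ is differentiable with $\Phi'(x)=0$. *)

theory Defs
  imports "HOL-Analysis.Analysis"
begin

text \<open>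
  The inner product on \<open>real ^ 'n ^ 'n\<close> is the entrywise one, and \<open>N = CARD('n)\<close>.
  Since \<open>0 powr a = 0\<close>, the determinant term vanishes at singular matrices,
  which is the intended value for \<open>p > 0\<close>.
\<close>

definition Phi ::
  "(real ^ 'n ^ 'n \<Rightarrow> real ^ 'n ^ 'n) \<Rightarrow> real ^ 'n ^ 'n \<Rightarrow> real \<Rightarrow> real ^ 'n ^ 'n \<Rightarrow> real"
  where "Phi A f p x =
    1 / 2 * (A x \<bullet> x)
    - real CARD('n) / p * \<bar>det x\<bar> powr (p / real CARD('n))
    - f \<bullet> x"

text \<open>
  Differentiability at \<open>x\<close> is part of the notion: \<open>F\<close> may fail to be
  differentiable at other points (as \<open>Phi\<close> does at some singular matrices when
  \<open>p \<le> N\<close>), and such points do not count as critical.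
\<close>

definition critical_point :: "('a::real_normed_vector \<Rightarrow> real) \<Rightarrow> 'a \<Rightarrow> bool"
  where "critical_point F x \<longleftrightarrow> (F has_derivative (\<lambda>h. 0)) (at x)"

end

theory Submission
  imports Defs
begin

text \<open>
  The map \<open>x \<mapsto> \<bar>det x\<bar>\<^bsup>p/N\<^esup> x\<^bsup>-T\<^esup>\<close>, the gradient of the determinant term, is invertible on the
  nonsingular matrices, and its inverse is the analogous map with \<open>p\<close> replaced by the conjugate
  exponent \<open>q = p / (p - 1) < 2\<close>. In terms of \<open>y = A x - f\<close> the equation \<open>\<Phi>'(x) = 0\<close> therefore becomes
  \<open>x = \<bar>det y\<bar>\<^bsup>r\<^esup> y\<^bsup>-T\<^esup>\<close> with \<open>r = q / N\<close>, the Euler equation of the dual functional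
  \<open>1/2 (A x, x) - 1/r \<bar>det (A x - f)\<bar>\<^bsup>r\<^esup>\<close>. As \<open>q < 2\<close>, this functional is coercive, so it has a
  minimizer. The matrix \<open>y\<close> is nonsingular there: second differences at a minimizer with
  \<open>det y = 0\<close> would give \<open>\<bar>det (y + w)\<bar>\<^bsup>r\<^esup> \<le> C \<bar>w\<bar>\<^sup>2\<close> for all \<open>w\<close>, whereas some \<open>w\<close> of size \<open>t\<close> has
  \<open>\<bar>det (y + w)\<bar>\<^bsup>r\<^esup>\<close> at least of order \<open>t\<^bsup>q\<^esup>\<close>.
\<close>

section \<open>Determinants: upper bound, derivative, perturbation\<close>

lemma abs_det_le_norm_power:
  fixes y :: "real ^ 'n ^ 'n"
  shows "\<bar>det y\<bar> \<le> fact CARD('n) * norm y ^ CARD('n)"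
proof -
  have entry: "\<bar>y $ i $ j\<bar> \<le> norm y" for i j
    using component_le_norm_cart[of "y $ i" j] Finite_Cartesian_Product.norm_nth_le[of y i] by linarith
  have "\<bar>det y\<bar> \<le> (\<Sum>q | q permutes (UNIV::'n set). norm y ^ CARD('n))"
    unfolding det_def
  proof (rule sum_abs[THEN order_trans], rule sum_mono)
    fix q :: "'n \<Rightarrow> 'n"
    have "(\<Prod>i\<in>UNIV. \<bar>y $ i $ q i\<bar>) \<le> (\<Prod>i\<in>(UNIV::'n set). norm y)"
      by (rule prod_mono) (simp add: entry)
    then show "\<bar>of_int (sign q) * (\<Prod>i\<in>UNIV. y $ i $ q i)\<bar> \<le> norm y ^ CARD('n)"
      by (simp add: abs_mult abs_prod sign_def)
  qed
  then show ?thesis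
    by (simp add: card_permutations[OF refl])
qed

lemma det_scaleR:
  fixes x :: "real ^ 'n ^ 'n"
  shows "det (c *\<^sub>R x) = c ^ CARD('n) * det x"
proof -
  have "c *\<^sub>R x = (\<chi> i. c *s x $ i)"
    by (simp add: vec_eq_iff)
  then show ?thesis
    using det_rows_mul[of "\<lambda>_. c" "\<lambda>i. x $ i"] by simp
qed

lemma continuous_on_det [continuous_intros]:
  fixes F :: "'a::topological_space \<Rightarrow> real ^ 'n ^ 'n"
  assumes "continuous_on S F"
  shows "continuous_on S (\<lambda>x. det (F x))"
  unfolding det_def by (intro continuous_intros assms)

text \<open>Product rule on the Leibniz formula: the terms that differentiate the entry in row
  \<open>k\<close> regroup to the determinant with that row replaced by
  \<open>h $ k\<close>.\<close>

lemma has_derivative_det_rows: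
  fixes x :: "real ^ 'n ^ 'n"
  shows "(det has_derivative
    (\<lambda>h. \<Sum>k\<in>UNIV. det (\<chi> i. if i = k then h $ i else x $ i))) (at x)"
proof -
  have split_prod: "(\<Prod>i\<in>UNIV. (if i = k then h $ i else x $ i) $ q i)
      = h $ k $ q k * (\<Prod>j\<in>UNIV - {k}. x $ j $ q j)"
    for h :: "real ^ 'n ^ 'n" and k :: 'n and q
  proof -
    have "(\<Prod>i\<in>UNIV - {k}. (if i = k then h $ i else x $ i) $ q i)
        = (\<Prod>j\<in>UNIV - {k}. x $ j $ q j)"
      by (rule prod.cong) auto
    then show ?thesis
      by (subst prod.remove[of UNIV k]) auto
  qed
  have entry: "((\<lambda>x. x $ i $ j) has_derivative (\<lambda>h. h $ i $ j)) (at x)" for i j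
    by (intro bounded_linear_imp_has_derivative
        bounded_linear_compose[OF bounded_linear_vec_nth bounded_linear_vec_nth])
  have "((\<lambda>x. \<Sum>q | q permutes UNIV. of_int (sign q) * (\<Prod>i\<in>UNIV. x $ i $ q i)) has_derivative
      (\<lambda>h. \<Sum>q | q permutes UNIV. of_int (sign q) *
        (\<Sum>k\<in>UNIV. h $ k $ q k * (\<Prod>j\<in>UNIV - {k}. x $ j $ q j)))) (at x)"
    by (intro has_derivative_sum has_derivative_mult_right has_derivative_prod entry)
  moreover have "(\<Sum>q | q permutes UNIV. of_int (sign q) *
        (\<Sum>k\<in>UNIV. h $ k $ q k * (\<Prod>j\<in>UNIV - {k}. x $ j $ q j)))
      = (\<Sum>k\<in>UNIV. det (\<chi> i. if i = k then h $ i else x $ i))" for h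
    unfolding det_def
    by (simp add: split_prod sum_distrib_left sum.swap[of _ UNIV])
  ultimately show ?thesis
    by (simp add: det_def[abs_def])
qed

text \<open>Jacobi's formula. Row \<open>k\<close> of \<open>h\<close> is a combination of the rows
  of \<open>x\<close> with coefficients from row \<open>k\<close> of \<open>h ** X\<close>; by
  Cramer's rule only the diagonal coefficient survives, and summing over \<open>k\<close> gives the
  trace of \<open>h ** X\<close>.\<close>

lemma has_derivative_det:
  fixes x X :: "real ^ 'n ^ 'n"
  assumes "X ** x = mat 1"
  shows "(det has_derivative (\<lambda>h. det x * (transpose X \<bullet> h))) (at x)"
proof -
  have row: "det (\<chi> i. if i = k then h $ i else x $ i) = (h ** X) $ k $ k * det x"
    for h :: "real ^ 'n ^ 'n" and k
  proof -
    have "h $ k = ((h ** X) ** x) $ k"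
      by (simp add: matrix_mul_assoc[symmetric] assms)
    also have "\<dots> = (\<Sum>i\<in>UNIV. (h ** X) $ k $ i *s row i x)"
      by (simp add: vec_eq_iff matrix_matrix_mult_def row_def)
    finally have "h $ k = (\<Sum>i\<in>UNIV. (h ** X) $ k $ i *s row i x)" .
    then have "(\<chi> i. if i = k then h $ i else x $ i)
        = (\<chi> i. if i = k then \<Sum>i\<in>UNIV. (h ** X) $ k $ i *s row i x else row i x)"
      by (auto simp: vec_eq_iff row_def)
    then show ?thesis
      using cramer_lemma_transpose[where x = "(h ** X) $ k" and A = x and k = k] by simp
  qed
  have trace: "(\<Sum>k\<in>UNIV. (h ** X) $ k $ k) = transpose X \<bullet> h" for h
    by (simp add: inner_vec_def transpose_def matrix_matrix_mult_def mult.commute)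
  have "(\<Sum>k\<in>UNIV. det (\<chi> i. if i = k then h $ i else x $ i)) = det x * (transpose X \<bullet> h)" for h
    by (simp only: row trace sum_distrib_right[symmetric] mult.commute[of "det x"])
  then show ?thesis
    using has_derivative_det_rows[of x] by simp
qed

lemma has_derivative_abs_det_powr:
  fixes x X :: "real ^ 'n ^ 'n"
  assumes "X ** x = mat 1"
  shows "((\<lambda>x. \<bar>det x\<bar> powr s) has_derivative
    (\<lambda>h. s * \<bar>det x\<bar> powr s * (transpose X \<bullet> h))) (at x)"
proof -
  have nz: "det x \<noteq> 0"
    using assms det_mul[of X x] by auto
  \<comment> \<open>Dividing by the signed \<open>det x\<close> gives one formula for both signs;
    this divisor later cancels against the factor \<open>det x\<close> in Jacobi's formula.\<close>
  have "((\<lambda>u. \<bar>u\<bar> powr s) has_real_derivative s * \<bar>det x\<bar> powr s / det x) (at (det x))"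
  proof (cases "det x > 0")
    case True
    have "((\<lambda>u. u powr s) has_real_derivative s * \<bar>det x\<bar> powr s / det x) (at (det x))"
      using True by (auto intro!: derivative_eq_intros simp: powr_diff)
    then show ?thesis
      by (rule has_field_derivative_transform_within_open[of _ _ _ "{0<..}"]) (use True in auto)
  next
    case False
    with nz have neg: "det x < 0"
      by simp
    then have "((\<lambda>u. (- u) powr s) has_real_derivative s * \<bar>det x\<bar> powr s / det x) (at (det x))"
      by (auto intro!: derivative_eq_intros simp: powr_diff)
    then show ?thesis
      by (rule has_field_derivative_transform_within_open[of _ _ _ "{..<0}"]) (use neg in auto)
  qed
  from has_derivative_compose[OF has_derivative_det[OF assms] this[unfolded has_field_derivative_def]]
  show ?thesis
    using nz by (simp add: mult_ac)
qed

text \<open>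
  The signs are chosen row by row: the determinants obtained from the two signs in
  a row differ by twice the determinant with that row replaced by \<open>t\<close> times a unit vector.
\<close>

lemma exists_perturbation_det_ge:
  fixes y :: "real ^ 'n ^ 'n"
  assumes "t \<ge> 0"
  obtains w where "norm w \<le> real CARD('n) * t" "t ^ CARD('n) \<le> \<bar>det (y + w)\<bar>"
proof -
  \<comment> \<open>Rows in \<open>S\<close> are already rows of \<open>y + w\<close>, the others
    are still \<open>t\<close> times unit vectors. \<open>S\<close> grows from the empty set, where
    the matrix is \<open>t\<close> times the identity, to \<open>UNIV\<close>.\<close>
  let ?M = "\<lambda>S e. (\<chi> i. if i \<in> S then y $ i + e i *\<^sub>R axis i t else axis i t) :: real ^ 'n ^ 'n"
  have "\<exists>e. (\<forall>i. \<bar>e i\<bar> = (1::real)) \<and> t ^ CARD('n) \<le> \<bar>det (?M S e)\<bar>" for S :: "'n set"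
  proof (induction S rule: finite_induct[OF finite])
    case 1
    have "det (?M {} (\<lambda>_. 1)) = t ^ CARD('n)"
      by (subst det_diagonal) (auto simp: axis_def)
    then show ?case
      by (intro exI[of _ "\<lambda>_. 1"]) simp
  next
    case (2 k S)
    then obtain e where e: "\<And>i. \<bar>e i\<bar> = (1::real)" "t ^ CARD('n) \<le> \<bar>det (?M S e)\<bar>"
      by blast
    let ?c = "\<lambda>i. ?M S e $ i"
    have upd: "?M (insert k S) (e(k := a)) = (\<chi> i. if i = k then y $ k + a *s axis k t else ?c i)" for a
      by (auto simp: vec_eq_iff)
    have "?M S e = (\<chi> i. if i = k then axis k t else ?c i)"
      using 2(2) by (auto simp: vec_eq_iff)
    then have "det (?M (insert k S) (e(k := a)))
        = det (\<chi> i. if i = k then y $ k else ?c i) + a * det (?M S e)" for a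
      unfolding upd det_row_add det_row_mul by simp
    from this[of 1] this[of "-1"]
    have "t ^ CARD('n) \<le> \<bar>det (?M (insert k S) (e(k := 1)))\<bar> \<or>
        t ^ CARD('n) \<le> \<bar>det (?M (insert k S) (e(k := - 1)))\<bar>"
      using e(2) by argo
    moreover have "\<forall>i. \<bar>(e(k := 1)) i\<bar> = 1" "\<forall>i. \<bar>(e(k := - 1)) i\<bar> = 1"
      using e(1) by auto
    ultimately show ?case
      by blast
  qed
  then obtain e where e: "\<And>i. \<bar>e i\<bar> = (1::real)" "t ^ CARD('n) \<le> \<bar>det (?M UNIV e)\<bar>"
    by blast
  let ?w = "(\<chi> i. e i *\<^sub>R axis i t) :: real ^ 'n ^ 'n"
  have "norm ?w \<le> (\<Sum>i\<in>(UNIV::'n set). norm (?w $ i))"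
    unfolding norm_vec_def[of ?w] by (rule L2_set_le_sum) simp
  also have "\<dots> = real CARD('n) * t"
  proof -
    have "axis i t = t *\<^sub>R axis i (1::real)" for i :: 'n
      by (simp add: vec_eq_iff axis_def)
    then show ?thesis
      using assms by (simp add: e(1) abs_mult)
  qed
  finally have "norm ?w \<le> real CARD('n) * t" .
  moreover have "?M UNIV e = y + ?w"
    by (simp add: vec_eq_iff)
  ultimately show thesis
    using e(2) by (intro that[of ?w]) auto
qed

section \<open>The dual functional and its minimizers\<close>

text \<open>For \<open>r = p / ((p - 1) * N)\<close> and nonsingular \<open>y = A z - f\<close>, the
  subtracted term is the Legendre transform, taken at the stationary point, of the determinant term
  of \<open>Phi\<close>. Working with \<open>z\<close> instead of \<open>y\<close> avoids the
  inverse of \<open>A\<close>.\<close>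

definition dual_functional ::
  "(real ^ 'n ^ 'n \<Rightarrow> real ^ 'n ^ 'n) \<Rightarrow> real ^ 'n ^ 'n \<Rightarrow> real \<Rightarrow> real ^ 'n ^ 'n \<Rightarrow> real"
  where "dual_functional A f r z = 1 / 2 * (A z \<bullet> z) - 1 / r * \<bar>det (A z - f)\<bar> powr r"

text \<open>Compactness gives a positive minimum on the unit sphere; homogeneity of degree 2 extends
  the bound to all vectors.\<close>

lemma positive_definite_coercive:
  fixes A :: "'a::euclidean_space \<Rightarrow> 'a"
  assumes "linear A" and pos: "\<And>x. x \<noteq> 0 \<Longrightarrow> A x \<bullet> x > 0"
  obtains c where "c > 0" "\<And>x. c * (norm x)\<^sup>2 \<le> A x \<bullet> x"
proof -
  let ?S = "sphere (0::'a) 1"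
  have "continuous_on ?S (\<lambda>x. A x \<bullet> x)"
    by (intro continuous_intros linear_continuous_on linear_conv_bounded_linear[THEN iffD1] assms(1))
  moreover have "?S \<noteq> {}"
    by simp
  ultimately obtain u where u: "u \<in> ?S" "\<And>x. x \<in> ?S \<Longrightarrow> A u \<bullet> u \<le> A x \<bullet> x"
    using continuous_attains_inf[OF compact_sphere, of 0 1 "\<lambda>x. A x \<bullet> x"] by blast
  have "A u \<bullet> u * (norm x)\<^sup>2 \<le> A x \<bullet> x" for x
  proof (cases "x = 0")
    case False
    have "A u \<bullet> u \<le> A (x /\<^sub>R norm x) \<bullet> (x /\<^sub>R norm x)"
      using False by (intro u(2)) simp
    also have "\<dots> = (A x \<bullet> x) / (norm x)\<^sup>2"
      by (simp add: linear_cmul[OF assms(1)] power2_eq_square field_simps)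
    finally show ?thesis
      using False by (simp add: field_simps)
  qed (simp add: linear_0[OF assms(1)])
  moreover have "A u \<bullet> u > 0"
    using u(1) by (intro pos) auto
  ultimately show thesis
    using that by blast
qed

text \<open>The determinant term grows at most with exponent \<open>r * N < 2\<close>, so the
  functional is nonnegative outside a large ball. As it is at most 0 at the origin, its minimum over
  the ball is global.\<close>

lemma dual_functional_attains_min:
  fixes A :: "real ^ 'n ^ 'n \<Rightarrow> real ^ 'n ^ 'n"
  assumes lin: "linear A" and pos: "\<And>x. x \<noteq> 0 \<Longrightarrow> A x \<bullet> x > 0"
    and r: "r > 0" "r * real CARD('n) < 2"
  obtains z where "\<And>w. dual_functional A f r z \<le> dual_functional A f r w"
proof -
  let ?N = "CARD('n)" and ?\<Psi> = "dual_functional A f r"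
  define s where "s = r * real ?N"
  obtain c where c: "c > 0" "\<And>x. c * (norm x)\<^sup>2 \<le> A x \<bullet> x"
    using positive_definite_coercive[OF lin pos] by blast
  obtain K where K: "K > 0" "\<And>x. norm (A x) \<le> K * norm x"
    using linear_bounded_pos[OF lin] by blast
  define L where "L = K + norm f"
  have L: "L > 0"
    using K(1) by (simp add: L_def add_pos_nonneg)
  define D where "D = (fact ?N * L ^ ?N) powr r"
  have D: "D > 0"
    using L by (simp add: D_def)
  \<comment> \<open>The entry 1 lets \<open>L * norm z\<close> absorb \<open>norm f\<close>. The
    other entry comes from solving \<open>D / r * t powr s = c / 2 * t^2\<close> for
    \<open>t\<close>; beyond it the quadratic side dominates.\<close>
  define T where "T = max 1 ((2 * D / (r * c)) powr (1 / (2 - s)))"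
  have far: "?\<Psi> z \<ge> 0" if "norm z \<ge> T" for z
  proof -
    let ?t = "norm z"
    have t: "?t \<ge> 1" "?t \<ge> (2 * D / (r * c)) powr (1 / (2 - s))"
      using that by (auto simp: T_def)
    have "norm (A z - f) \<le> K * ?t + norm f"
      using norm_triangle_ineq4[of "A z" f] K(2)[of z] by linarith
    also have "\<dots> \<le> L * ?t"
      using t(1) by (simp add: L_def distrib_right mult_le_cancel_left1)
    finally have "fact ?N * norm (A z - f) ^ ?N \<le> fact ?N * (L * ?t) ^ ?N"
      by (intro mult_left_mono power_mono) auto
    from order_trans[OF abs_det_le_norm_power this]
    have "\<bar>det (A z - f)\<bar> \<le> fact ?N * L ^ ?N * ?t ^ ?N"
      by (simp add: power_mult_distrib mult.assoc)
    then have "\<bar>det (A z - f)\<bar> powr r \<le> (fact ?N * L ^ ?N * ?t ^ ?N) powr r"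
      using r(1) by (intro powr_mono2) auto
    also have "\<dots> = D * (?t ^ ?N) powr r"
      using L by (simp add: D_def powr_mult)
    also have "(?t ^ ?N) powr r = ?t powr s"
      using t(1) by (subst powr_realpow[symmetric]) (auto simp: s_def powr_powr mult.commute)
    finally have det: "\<bar>det (A z - f)\<bar> powr r \<le> D * ?t powr s" .
    have "2 * D / (r * c) = ((2 * D / (r * c)) powr (1 / (2 - s))) powr (2 - s)"
      using r c(1) D by (simp add: powr_powr s_def)
    also have "\<dots> \<le> ?t powr (2 - s)"
      using t r(2) by (intro powr_mono2) (auto simp: s_def)
    finally have "2 * D / (r * c) * ?t powr s \<le> ?t powr (2 - s) * ?t powr s"
      by (intro mult_right_mono) auto
    also have "\<dots> = ?t\<^sup>2"
      using t(1) by (simp flip: powr_add)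
    finally have "1 / r * (D * ?t powr s) \<le> 1 / 2 * (c * ?t\<^sup>2)"
      using r(1) c(1) by (simp add: field_simps)
    moreover have "1 / r * \<bar>det (A z - f)\<bar> powr r \<le> 1 / r * (D * ?t powr s)"
      using det r(1) by (intro mult_left_mono) auto
    ultimately show ?thesis
      using c(2)[of z] unfolding dual_functional_def by linarith
  qed
  have contA: "continuous_on S A" for S
    by (intro linear_continuous_on linear_conv_bounded_linear[THEN iffD1] lin)
  \<comment> \<open>Continuity includes the points where \<open>A z - f\<close> is singular, because
    \<open>r > 0\<close>.\<close>
  have "continuous_on (cball 0 T) ?\<Psi>"
    unfolding dual_functional_def using r(1)
    by (intro continuous_intros contA continuous_on_powr') auto
  moreover have "cball (0::real^'n^'n) T \<noteq> {}"
    by (simp add: T_def)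
  ultimately obtain z where z: "\<And>w. w \<in> cball 0 T \<Longrightarrow> ?\<Psi> z \<le> ?\<Psi> w"
    using continuous_attains_inf[OF compact_cball] by metis
  have "?\<Psi> 0 \<le> 0"
    using r(1) by (simp add: dual_functional_def)
  moreover have "?\<Psi> z \<le> ?\<Psi> 0"
    by (rule z) (simp add: T_def)
  ultimately have "?\<Psi> z \<le> ?\<Psi> w" for w
    using z[of w] far[of w] by (cases "norm w \<le> T") auto
  then show thesis
    by (rule that)
qed

lemma dual_minimizer_nonsingular:
  fixes A :: "real ^ 'n ^ 'n \<Rightarrow> real ^ 'n ^ 'n"
  assumes lin: "linear A" and surj: "surj A"
    and r: "r > 0" "r * real CARD('n) < 2"
    and min: "\<And>w. dual_functional A f r z \<le> dual_functional A f r w"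
  shows "det (A z - f) \<noteq> 0"
proof
  assume sing: "det (A z - f) = 0"
  let ?N = "CARD('n)" and ?y = "A z - f"
  obtain B where B: "linear B" "\<And>w. A (B w) = w"
    using linear_surjective_right_inverse[OF lin surj] by (metis comp_apply id_apply)
  obtain K where K: "K > 0" "\<And>w. norm (B w) \<le> K * norm w"
    using linear_bounded_pos[OF B(1)] by blast
  \<comment> \<open>Moving \<open>z\<close> by \<open>B w\<close> and \<open>- B w\<close> moves
    \<open>A z - f\<close> by \<open>w\<close> and \<open>- w\<close>. In the sum of the two values
    the terms linear in \<open>w\<close> cancel, and the determinant term at \<open>z\<close> is 0,
    so only \<open>w \<bullet> B w\<close> is left to bound the determinant terms.\<close>
  have growth: "\<bar>det (?y + w)\<bar> powr r \<le> r * K * (norm w)\<^sup>2" for w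
  proof -
    have "2 * dual_functional A f r z
        \<le> dual_functional A f r (z + B w) + dual_functional A f r (z - B w)"
      using min[of "z + B w"] min[of "z - B w"] by linarith
    also have "\<dots> = 2 * dual_functional A f r z + w \<bullet> B w
        - 1 / r * (\<bar>det (?y + w)\<bar> powr r + \<bar>det (?y - w)\<bar> powr r)"
      by (simp add: dual_functional_def linear_add[OF lin] linear_diff[OF lin] B(2) sing
          inner_simps algebra_simps)
    finally have "1 / r * \<bar>det (?y + w)\<bar> powr r + 1 / r * \<bar>det (?y - w)\<bar> powr r \<le> w \<bullet> B w"
      by (simp add: algebra_simps)
    moreover have "0 \<le> 1 / r * \<bar>det (?y - w)\<bar> powr r"
      using r(1) by simp
    moreover have "w \<bullet> B w \<le> norm w * (K * norm w)"
      using norm_cauchy_schwarz[of w "B w"] mult_left_mono[OF K(2)[of w] norm_ge_zero[of w]]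
      by linarith
    ultimately have "1 / r * \<bar>det (?y + w)\<bar> powr r \<le> norm w * (K * norm w)"
      by linarith
    then show ?thesis
      using r(1) by (simp add: field_simps power2_eq_square)
  qed
  define C where "C = r * K * (real ?N)\<^sup>2"
  have C: "C > 0"
    using r(1) K(1) by (simp add: C_def)
  define s where "s = r * real ?N"
  have bound: "t powr s \<le> C * t\<^sup>2" if "t > 0" for t
  proof -
    obtain w where w: "norm w \<le> real ?N * t" "t ^ ?N \<le> \<bar>det (?y + w)\<bar>"
      using exists_perturbation_det_ge[of t ?y] \<open>t > 0\<close> by auto
    have "t powr s = (t ^ ?N) powr r"
      using \<open>t > 0\<close> by (simp add: s_def powr_powr mult.commute flip: powr_realpow)
    also have "\<dots> \<le> \<bar>det (?y + w)\<bar> powr r"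
      using w(2) \<open>t > 0\<close> r(1) by (intro powr_mono2) auto
    also have "\<dots> \<le> r * K * (norm w)\<^sup>2"
      by (rule growth)
    also have "\<dots> \<le> r * K * (real ?N * t)\<^sup>2"
      using w(1) r(1) K(1) by (intro mult_left_mono power_mono) auto
    finally show ?thesis
      by (simp add: C_def power_mult_distrib mult_ac)
  qed
  \<comment> \<open>This \<open>t\<close> solves \<open>C * t^2 = t powr s / 2\<close>, which
    violates \<open>bound\<close>.\<close>
  define t where "t = (1 / (2 * C)) powr (1 / (2 - s))"
  have t: "t > 0"
    using C by (simp add: t_def)
  have "t powr (2 - s) = 1 / (2 * C)"
    using C r(2) by (simp add: t_def powr_powr s_def)
  then have "C * t\<^sup>2 = t powr s / 2"
    using t C by (simp add: powr_diff field_simps)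
  moreover have "t powr s > 0"
    using t by simp
  ultimately show False
    using bound[OF t] by linarith
qed

section \<open>From the dual minimizer to a critical point of \<open>Phi\<close>\<close>

theorem proposition8:
  fixes A :: "real ^ 'n ^ 'n \<Rightarrow> real ^ 'n ^ 'n"
    and f :: "real ^ 'n ^ 'n"
    and p :: real
  assumes "linear A"
    and "\<And>x y. A x \<bullet> y = x \<bullet> A y"
    and "\<And>x. x \<noteq> 0 \<Longrightarrow> A x \<bullet> x > 0"
    and "p > 2"
  shows "\<exists>x. x \<noteq> 0 \<and> critical_point (Phi A f p) x"
proof -
  let ?N = "CARD('n)"
  define r where "r = p / ((p - 1) * real ?N)"
  have N: "real ?N > 0"
    by simp
  have r: "r > 0" "r * real ?N < 2"
    using assms(4) N by (auto simp: r_def field_simps)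
  \<comment> \<open>With \<open>q = r * N\<close> conjugate to \<open>p\<close>, this is
    \<open>(q - 1) * p = q\<close> divided by \<open>N\<close>; it converts
    \<open>d powr (q - 1)\<close> into \<open>d powr r\<close> below.\<close>
  have rN: "(r * real ?N - 1) * (p / real ?N) = r"
    using assms(4) by (simp add: r_def field_simps)
  note lin = assms(1) and sym = assms(2) and pos = assms(3)
  have inj: "inj A"
    using pos by (metis inner_zero_left lin linear_injective_0 order_less_irrefl)
  note has_derivative_A = bounded_linear_imp_has_derivative[OF lin[unfolded linear_conv_bounded_linear]]
  obtain x where x_min: "\<And>w. dual_functional A f r x \<le> dual_functional A f r w"
    using dual_functional_attains_min[OF lin pos r] by blast
  let ?y = "A x - f"
  have ynz: "det ?y \<noteq> 0"
    using dual_minimizer_nonsingular[OF lin linear_inj_imp_surj[OF lin inj] r x_min] .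
  define d where "d = \<bar>det ?y\<bar>"
  have d: "d > 0"
    using ynz by (simp add: d_def)
  obtain Y where Y: "?y ** Y = mat 1" "Y ** ?y = mat 1"
    using ynz invertible_det_nz[of ?y] by (auto simp: invertible_def)
  have quad: "((\<lambda>z. 1 / 2 * (A z \<bullet> z)) has_derivative (\<lambda>h. A x \<bullet> h)) (at x)"
  proof (rule has_derivative_eq_rhs)
    show "((\<lambda>z. 1 / 2 * (A z \<bullet> z)) has_derivative (\<lambda>h. 1 / 2 * (A x \<bullet> h + A h \<bullet> x))) (at x)"
      by (intro has_derivative_mult_right has_derivative_inner has_derivative_A has_derivative_ident)
    show "(\<lambda>h. 1 / 2 * (A x \<bullet> h + A h \<bullet> x)) = (\<lambda>h. A x \<bullet> h)"
      using sym by (simp add: fun_eq_iff inner_commute)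
  qed
  have "((\<lambda>z. \<bar>det (A z - f)\<bar> powr r) has_derivative
      (\<lambda>h. r * d powr r * (transpose Y \<bullet> A h))) (at x)"
    unfolding d_def
  proof (rule has_derivative_compose[where f = "\<lambda>z. A z - f" and g = "\<lambda>y. \<bar>det y\<bar> powr r"])
    show "((\<lambda>z. A z - f) has_derivative A) (at x)"
      using has_derivative_diff[OF has_derivative_A has_derivative_const] by simp
  qed (rule has_derivative_abs_det_powr[OF Y(2)])
  then have "(dual_functional A f r has_derivative
      (\<lambda>h. A x \<bullet> h - 1 / r * (r * d powr r * (transpose Y \<bullet> A h)))) (at x)"
    unfolding dual_functional_def
    by (intro has_derivative_diff quad has_derivative_mult_right)
  then have "(\<lambda>h. A x \<bullet> h - 1 / r * (r * d powr r * (transpose Y \<bullet> A h))) = (\<lambda>h. 0)"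
    by (rule has_derivative_local_min) (simp add: x_min)
  then have "A x \<bullet> h = d powr r * (transpose Y \<bullet> A h)" for h
    using r(1) by (simp add: fun_eq_iff)
  then have "(x - d powr r *\<^sub>R transpose Y) \<bullet> A h = 0" for h
    by (simp add: inner_diff_left sym)
  \<comment> \<open>Taking the left factor itself as \<open>h\<close>, positive definiteness forces
    it to vanish.\<close>
  then have x_eq: "x = d powr r *\<^sub>R transpose Y"
    using pos by (metis eq_iff_diff_eq_0 inner_commute order_less_irrefl)
  define X where "X = d powr (- r) *\<^sub>R transpose ?y"
  have X: "X ** x = mat 1"
  proof -
    have "X ** x = (d powr (- r) * d powr r) *\<^sub>R (transpose ?y ** transpose Y)"
      by (simp add: X_def x_eq scalar_matrix_assoc[symmetric] matrix_scalar_ac)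
    also have "transpose ?y ** transpose Y = mat 1"
      by (simp add: Y matrix_transpose_mul[symmetric])
    finally show ?thesis
      using d by (simp flip: powr_add)
  qed
  \<comment> \<open>Read off from the inverse: \<open>det X\<close> is explicit in \<open>d\<close>,
    and \<open>det X * det x = 1\<close>.\<close>
  have det_x: "\<bar>det x\<bar> = d powr (r * real ?N - 1)"
  proof -
    have "det X = (d powr (- r)) ^ ?N * det ?y"
      by (simp add: X_def det_scaleR)
    then have "\<bar>det X\<bar> = (d powr (- r)) ^ ?N * d"
      by (simp add: abs_mult flip: d_def)
    also have "(d powr (- r)) ^ ?N = d powr (- r * real ?N)"
      using d by (subst powr_realpow[symmetric]) (auto simp: powr_powr)
    also have "d powr (- r * real ?N) * d = d powr (1 - r * real ?N)"
      using d by (simp add: powr_diff powr_minus divide_simps)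
    finally have "\<bar>det X\<bar> = d powr (1 - r * real ?N)" .
    moreover have "\<bar>det X\<bar> * \<bar>det x\<bar> = 1"
      using X det_mul[of X x] by (simp flip: abs_mult)
    moreover have "d powr (1 - r * real ?N) * d powr (r * real ?N - 1) = 1"
      using d by (simp flip: powr_add)
    moreover have "d powr (1 - r * real ?N) \<noteq> 0"
      using d by simp
    ultimately show ?thesis
      by (metis mult_left_cancel)
  qed
  have "\<bar>det x\<bar> powr (p / real ?N) = d powr r"
    by (simp only: det_x powr_powr rN)
  \<comment> \<open>The powers \<open>d powr r\<close> and \<open>d powr (- r)\<close> cancel: the
    gradient of the determinant term at \<open>x\<close> is \<open>A x - f\<close>, which is the
    Euler equation of \<open>Phi\<close>.\<close>
  then have grad: "\<bar>det x\<bar> powr (p / real ?N) *\<^sub>R transpose X = ?y"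
    using d by (simp add: X_def transpose_scalar flip: powr_add)
  have "((\<lambda>x. \<bar>det x\<bar> powr (p / real ?N)) has_derivative
      (\<lambda>h. p / real ?N * \<bar>det x\<bar> powr (p / real ?N) * (transpose X \<bullet> h))) (at x)"
    by (rule has_derivative_abs_det_powr[OF X])
  then have "(Phi A f p has_derivative (\<lambda>h. A x \<bullet> h
      - real ?N / p * (p / real ?N * \<bar>det x\<bar> powr (p / real ?N) * (transpose X \<bullet> h))
      - f \<bullet> h)) (at x)"
    unfolding Phi_def
    by (intro has_derivative_diff quad has_derivative_mult_right has_derivative_inner_right
        has_derivative_ident)
  moreover have "A x \<bullet> h
      - real ?N / p * (p / real ?N * \<bar>det x\<bar> powr (p / real ?N) * (transpose X \<bullet> h))
      - f \<bullet> h = 0" for h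
    using arg_cong[OF grad, of "\<lambda>v. v \<bullet> h"] assms(4) by (simp add: inner_diff_left)
  ultimately have "critical_point (Phi A f p) x"
    by (simp add: critical_point_def)
  \<comment> \<open>\<open>\<bar>det x\<bar>\<close> is a power of \<open>d > 0\<close>, hence
    nonzero, while the norm bound gives determinant 0 at the zero matrix.\<close>
  moreover have "x \<noteq> 0"
    using det_x d abs_det_le_norm_power[of x] by (auto simp: zero_power)
  ultimately show ?thesis
    by blast
qed

end
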